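(* Let $n\ge 2$, let $S$ be a closed, connected, oriented surface of genus $g\geq 2$, let $\rho\colon\pi_1(S)\to \mathrm{PSL}_n(\mathbb{R})$ be a Hitchin representation, and let $\ell^\rho_i\colon \mathcal C^{\mathrm{H\ddot ol}}(S)\to\mathbb{R}$, $i=1,\dots,n$, be the length functions of $\rho$ (defined by $\ell_i^\rho(\alpha)=\int_{T^1S}\omega_i\,d\alpha$). Then each restriction ${\ell^\rho_i}_{|\mathcal{ML}(S)}\colon\mathcal{ML}(S)\to\mathbb{R}$ to the space of measured laminations is tangentiable, namely, if $(\alpha_t)_{t\ge0}\subset\mathcal{ML}(S)$ is a smooth $1$-parameter family of measured laminations with tangent vector $\dot\alpha_0=\frac{d}{dt^+}{\alpha_t}_{|t=0}$ at $\alpha_0$, then $$\frac{d}{dt^+}{\ell^\rho_i(\alpha_t)}_{|t=0}=\ell_i^\rho(\dot\alpha_0).$$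
   Context: Hitchin representations. An $n$-Fuchsian representation is a homomorphism $\iota\circ r\colon\pi_1(S)\to\mathrm{PSL}_n(\mathbb{R})$, where $r\colon\pi_1(S)\to\mathrm{PSL}_2(\mathbb{R})$ is discrete and injective and $\iota\colon \mathrm{PSL}_2(\mathbb{R})\to\mathrm{PSL}_n(\mathbb{R})$ is induced by the $n$-dimensional irreducible representation $\mathrm{SL}_2(\mathbb{R})\to \mathrm{SL}_n(\mathbb{R})$. A Hitchin representation is a homomorphism lying in a component (Hitchin component) of the character variety $\mathrm{Hom}(\pi_1(S),\mathrm{PSL}_n(\mathbb{R}))/\!/\mathrm{PSL}_n(\mathbb{R})$ that contains an $n$-Fuchsian representation. It lifts to a representation $\rho\colon\pi_1(S)\to\mathrm{SL}_n(\mathbb{R})$, still denoted $\rho$. By a theorem of Labourie (known), for every nontrivial $\gamma\in\pi_1(S)$ the matrix $\rho(\gamma)$ is diagonalizable with real eigenvalues of distinct absolute values; they are indexed so that $|\lambda^\rho_1(\gamma)|>\dots>|\lambda^\rho_n(\gamma)|$. Geodesic foliation. Fix an auxiliary hyperbolic metric $m_0$ on $S$, with geodesic flow $(g_t)_{t\in\mathbb{R}}$ on the unit tangent bundle $T^1S$. The orbits of $(g_t)$ form a $1$-dimensional foliation $\mathcal F$ of $T^1S$, the geodesic foliation. Hölder geodesic currents. A Hölder distribution on a metric space $X$ is a continuous linear functional on the space of compactly supported Hölder continuous functions $X\to\mathbb{R}$ (continuous for the Hölder norm, for each fixed Hölder exponent and each fixed compact set containing the supports). A Hölder geodesic current $\alpha$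 assigns a Hölder distribution $\alpha_D$ to every surface $D\subset T^1S$ transverse to $\mathcal F$, such that $\alpha_D|_{D'}=\alpha_{D'}$ for every subsurface $D'\subset D$, and $\alpha_D=h^*\alpha_{D''}$ for every Hölder homotopy $h\colon D\to D''$ preserving $\mathcal F$ from $D$ to another transverse surface $D''$. It is a measure geodesic current if every $\alpha_D$ is a positive Radon measure. $\mathcal C^{\mathrm{H\ddot ol}}(S)$ is the real vector space of Hölder geodesic currents, $\mathcal C(S)$ the subset of measure geodesic currents. $\mathcal C^{\mathrm{H\ddot ol}}(S)$ has the weak-* topology: the weakest topology for which all functions $\alpha\mapsto\alpha_D(\varphi)$ are continuous, with $D$ transverse to $\mathcal F$ and $\varphi$ compactly supported and Hölder continuous on $D$. A primitive closed oriented curve $\gamma$ is identified with the transverse Dirac (counting) measure of the closed leaf $\gamma^*$ of $\mathcal F$ corresponding to the closed geodesic homotopic to $\gamma$. Measured laminations. Let $\mathfrak R(u)=-u$ on $T^1S$, and let $\mathfrak R^*\alpha(\varphi)=\alpha(\varphi\circ\mathfrak R)$. A closed unoriented curve $\bar\gamma$ is identified with the current $\frac12\gamma+\frac12\mathfrak R^*\gamma$. $\mathcal{ML}(S)$ is the closure in $\mathcal C(S)$ of the set of positive real multiples of homotopy classes of simple, closed, unoriented curves. It is a piecewise linear manifold homeomorphic to $\mathbb{R}^{6g-6}$ (Thurston), so it has tangent vectors. By Bonahon (known), these tangent vectors are interpreted as Hölder geodesic currents: for a $1$-parameter family $(\alpha_t)_{t\ge0}\subset\mathcal{ML}(S)$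 with a tangent vector at $t=0$, $\dot\alpha_0=\lim_{t\to0^+}\frac{\alpha_t-\alpha_0}{t}$ in $\mathcal C^{\mathrm{H\ddot ol}}(S)$. Here $\frac{d}{dt^+}$ denotes the right derivative. Eigenbundles. Let $T^1S\times_\rho\mathbb{R}^n=(T^1\widetilde S\times\mathbb{R}^n)/\pi_1(S)$ be the flat bundle, where $\widetilde S$ is the universal cover and $\gamma(u,X)=(\gamma u,\rho(\gamma)X)$. Let $(G_t)$ be the flow on it lifting $(g_t)$ via the flat connection (upstairs it is the geodesic flow on $T^1\widetilde S$ and trivial on $\mathbb{R}^n$). By a theorem of Labourie (known), the bundle splits as $V_1\oplus\dots\oplus V_n$, with line subbundles $V_i\to T^1S$ such that: each $V_i$ is $(G_t)$-invariant; if $g_{t_0}(u)=u$ with $t_0>0$ and $\gamma\in\pi_1(S)$ represents this closed orbit, then $G_{t_0}$ acts on $V_i(u)$ as multiplication by $1/\lambda_i^\rho(\gamma)$; $V_i(u)$ depends smoothly on $u$ along the leaves of $\mathcal F$ and is transversally Hölder continuous. Length functions. Pick a Riemannian metric $\|\cdot\|$ on the vector bundle $T^1S\times_\rho\mathbb{R}^n\to T^1S$. For a leaf $\mathcal L$ of $\mathcal F$, $u_0\in\mathcal L$ and $0\ne X_i(u_0)\in V_i(u_0)$, set $f_{X_i(u_0)}(g_t(u_0))=\log\|G_tX_i(u_0)\|_{g_t(u_0)}$ for $t$ near $0$, and $\omega_i=-df_{X_i(u_0)}$, the differential being taken along $\mathcal L$. This is a well-defined $1$-form along the leaves of $\mathcal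 F$ (smooth along leaves, transversally Hölder continuous). Cover $T^1S$ by finitely many flow boxes $\mathcal U_j\cong D_j\times(0,1)$ (with each $\{x\}\times(0,1)$ an arc in a leaf of $\mathcal F$), with subordinate partition of unity $\{\xi_j\}$; put $\phi_j(x)=\int_{\{x\}\times(0,1)}\xi_j\omega_i$, a compactly supported Hölder continuous function on $D_j$, and $\ell^\rho_i(\alpha)=\int_{T^1S}\omega_i\,d\alpha:=\sum_j\alpha_{D_j}(\phi_j)$. The number $\ell_i^\rho(\alpha)$ does not depend on the choices of flow boxes, partition of unity and Riemannian metric. *)

theory Defs
  imports "HOL-Analysis.Analysis" "HOL-Homology.Homology"
begin

section \<open>General topology and smoothness\<close>

definition quotient_top :: "'a topology \<Rightarrow> ('a \<Rightarrow> 'b) \<Rightarrow> 'b topology" where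
  "quotient_top X q =
     topology (\<lambda>U. U \<subseteq> q ` topspace X \<and> openin X {x \<in> topspace X. q x \<in> U})"

lemma openin_quotient_top:
  "openin (quotient_top X q) U \<longleftrightarrow>
     U \<subseteq> q ` topspace X \<and> openin X {x \<in> topspace X. q x \<in> U}"
proof -
  have "istopology (\<lambda>U. U \<subseteq> q ` topspace X \<and> openin X {x \<in> topspace X. q x \<in> U})"
    unfolding istopology_def
  proof (intro conjI allI impI)
    fix S T
    assume S: "S \<subseteq> q ` topspace X \<and> openin X {x \<in> topspace X. q x \<in> S}"
      and T: "T \<subseteq> q ` topspace X \<and> openin X {x \<in> topspace X. q x \<in> T}"
    show "S \<inter> T \<subseteq> q ` topspace X" using S by blast
    have "{x \<in> topspace X. q x \<in> S \<inter> T} =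
        {x \<in> topspace X. q x \<in> S} \<inter> {x \<in> topspace X. q x \<in> T}" by blast
    then show "openin X {x \<in> topspace X. q x \<in> S \<inter> T}" using S T by (simp add: openin_Int)
  next
    fix \<K>
    assume K: "\<forall>K\<in>\<K>. K \<subseteq> q ` topspace X \<and> openin X {x \<in> topspace X. q x \<in> K}"
    show "\<Union>\<K> \<subseteq> q ` topspace X" using K by blast
    have "{x \<in> topspace X. q x \<in> \<Union>\<K>} = \<Union>((\<lambda>K. {x \<in> topspace X. q x \<in> K}) ` \<K>)" by blast
    then show "openin X {x \<in> topspace X. q x \<in> \<Union>\<K>}" using K by (auto intro!: openin_Union)
  qed
  then show ?thesis unfolding quotient_top_def by (simp add: topology_inverse')
qed

lemma topspace_quotient_top: "topspace (quotient_top X q) = q ` topspace X"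
proof
  show "topspace (quotient_top X q) \<subseteq> q ` topspace X"
    using iffD1[OF openin_quotient_top[of X q "topspace (quotient_top X q)"] openin_topspace]
    by (rule conjunct1)
  have "{x \<in> topspace X. q x \<in> q ` topspace X} = topspace X" by blast
  then have "openin (quotient_top X q) (q ` topspace X)" by (simp add: openin_quotient_top)
  then show "q ` topspace X \<subseteq> topspace (quotient_top X q)" by (rule openin_subset)
qed

primrec Ck_on :: "nat \<Rightarrow> 'a::euclidean_space set \<Rightarrow> ('a \<Rightarrow> 'b::real_normed_vector) \<Rightarrow> bool" where
  "Ck_on 0 U f \<longleftrightarrow> continuous_on U f"
| "Ck_on (Suc k) U f \<longleftrightarrow>
     f differentiable_on U \<and> (\<forall>v. Ck_on k U (\<lambda>x. frechet_derivative f (at x) v))"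

text \<open>\<open>C\<^sup>\<infinity>\<close>-functions; only used for open \<open>U\<close>.\<close>

definition smooth_on :: "'a::euclidean_space set \<Rightarrow> ('a \<Rightarrow> 'b::real_normed_vector) \<Rightarrow> bool" where
  "smooth_on U f \<longleftrightarrow> (\<forall>k. Ck_on k U f)"


section \<open>The groups \<open>SL\<^sub>n(\<real>)\<close> and \<open>PSL\<^sub>n(\<real>)\<close>\<close>

definition SL :: "(real^'n^'n) monoid" where
  "SL = \<lparr>carrier = {A. det A = 1}, monoid.mult = (**), one = mat 1\<rparr>"

definition SL_center :: "(real^'n^'n) set" where
  "SL_center = {A \<in> carrier SL. \<forall>B \<in> carrier SL. A ** B = B ** A}"

text \<open>Elements of \<open>PSL\<close> are cosets, i.e. sets of matrices.\<close>

definition PSL :: "(real^'n^'n) set monoid" where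
  "PSL = SL Mod SL_center"

definition to_PSL :: "real^'n^'n \<Rightarrow> (real^'n^'n) set" where
  "to_PSL A = SL_center #>\<^bsub>SL\<^esub> A"

definition PSL_top :: "(real^'n^'n) set topology" where
  "PSL_top = quotient_top (top_of_set (carrier SL)) to_PSL"

type_synonym psl2 = "(real^2^2) set"


section \<open>The hyperbolic plane, its unit tangent bundle and its geodesic flow\<close>

definition HP :: "complex set" where
  "HP = {z. Im z > 0}"

definition mobius :: "real^2^2 \<Rightarrow> complex \<Rightarrow> complex" where
  "mobius A z = (of_real (A$1$1) * z + of_real (A$1$2)) / (of_real (A$2$1) * z + of_real (A$2$2))"

definition hyp_dist :: "complex \<Rightarrow> complex \<Rightarrow> real" where
  "hyp_dist z w = arcosh (1 + (cmod (z - w))\<^sup>2 / (2 * Im z * Im w))"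

text \<open>A tangent vector is a pair (base point, vector); it is a unit vector for
  \<open>|dz| / Im z\<close> iff the Euclidean norm of the vector is the height of the base point.\<close>

type_synonym tvec = "complex \<times> complex"

definition T1H :: "tvec set" where
  "T1H = {(z, v). z \<in> HP \<and> cmod v = Im z}"

text \<open>The second component is the derivative of the Moebius map, for \<open>det A = 1\<close>.\<close>

definition dmobius :: "real^2^2 \<Rightarrow> tvec \<Rightarrow> tvec" where
  "dmobius A u = (mobius A (fst u), snd u / (of_real (A$2$1) * fst u + of_real (A$2$2))\<^sup>2)"

text \<open>Unit speed geodesics are the images of \<open>t \<mapsto> e\<^sup>t \<i>\<close> under orientation preserving
  isometries; the isometry below is unique up to sign.\<close>

definition gflow :: "real \<Rightarrow> tvec \<Rightarrow> tvec" where
  "gflow t u = (let A = SOME A. A \<in> carrier SL \<and> dmobius A (\<i>, \<i>) = u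
                in dmobius A (of_real (exp t) * \<i>, of_real (exp t) * \<i>))"

definition gfield :: "tvec \<Rightarrow> tvec" where
  "gfield u = vector_derivative (\<lambda>t. gflow t u) (at 0)"

definition reverse :: "tvec \<Rightarrow> tvec" where
  "reverse u = (fst u, - snd u)"

text \<open>Since distances between points of two geodesics are convex functions of time, this is
  \<open>max {hyp_dist (fst (gflow t u)) (fst (gflow t v)) | t. t \<in> {0..1}}\<close>. It is invariant under
  isometries, and locally bi-Lipschitz equivalent to every Riemannian metric because
  \<open>u \<mapsto> (fst u, fst (gflow 1 u))\<close> is an embedding.\<close>

definition T1H_dist :: "tvec \<Rightarrow> tvec \<Rightarrow> real" where
  "T1H_dist u v =
     max (hyp_dist (fst u) (fst v)) (hyp_dist (fst (gflow 1 u)) (fst (gflow 1 v)))"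

text \<open>The covering of \<open>T1H\<close> by an open subset of \<open>\<real>\<^sup>3\<close>, which expresses smoothness of functions
  defined on \<open>T1H\<close>.\<close>

definition T1H_chart :: "complex \<times> real \<Rightarrow> tvec" where
  "T1H_chart p = (fst p, of_real (Im (fst p)) * cis (snd p))"

definition smooth_T1H :: "(tvec \<Rightarrow> real) \<Rightarrow> bool" where
  "smooth_T1H f \<longleftrightarrow> smooth_on (HP \<times> UNIV) (\<lambda>p. f (T1H_chart p))"


section \<open>Closed hyperbolic surfaces\<close>

text \<open>A closed oriented surface with a hyperbolic metric is \<open>\<Gamma> \<setminus> HP\<close>, where the deck group
  \<open>\<Gamma> \<subseteq> PSL\<^sub>2(\<real>)\<close> is the fundamental group.\<close>

definition act :: "psl2 \<Rightarrow> complex \<Rightarrow> complex" where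
  "act \<gamma> z = mobius (SOME A. A \<in> \<gamma>) z"

definition dact :: "psl2 \<Rightarrow> tvec \<Rightarrow> tvec" where
  "dact \<gamma> u = dmobius (SOME A. A \<in> \<gamma>) u"

abbreviation group_of :: "psl2 set \<Rightarrow> psl2 monoid" where
  "group_of \<Gamma> \<equiv> PSL\<lparr>carrier := \<Gamma>\<rparr>"

definition surface :: "psl2 set \<Rightarrow> complex set topology" where
  "surface \<Gamma> = quotient_top (top_of_set HP) (\<lambda>z. (\<lambda>\<gamma>. act \<gamma> z) ` \<Gamma>)"

definition closed_hyperbolic_surface :: "psl2 set \<Rightarrow> nat \<Rightarrow> bool" where
  "closed_hyperbolic_surface \<Gamma> genus \<longleftrightarrow>
     subgroup \<Gamma> PSL \<and>
     (\<forall>\<gamma>\<in>\<Gamma>. \<forall>z\<in>HP. act \<gamma> z = z \<longrightarrow> \<gamma> = \<one>\<^bsub>PSL\<^esub>) \<and>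
     (\<forall>K. compact K \<and> K \<subseteq> HP \<longrightarrow> finite {\<gamma> \<in> \<Gamma>. act \<gamma> ` K \<inter> K \<noteq> {}}) \<and>
     compact_space (surface \<Gamma>) \<and>
     homology_group 1 (surface \<Gamma>) \<cong> free_Abelian_group {..<2 * genus}"

definition orb :: "psl2 set \<Rightarrow> tvec \<Rightarrow> tvec set" where
  "orb \<Gamma> u = (\<lambda>\<gamma>. dact \<gamma> u) ` \<Gamma>"

text \<open>The unit tangent bundle \<open>T\<^sup>1S = \<Gamma> \<setminus> T1H\<close>; its points are orbits.\<close>

definition T1S :: "psl2 set \<Rightarrow> tvec set topology" where
  "T1S \<Gamma> = quotient_top (top_of_set T1H) (orb \<Gamma>)"

definition T1S_dist :: "tvec set \<Rightarrow> tvec set \<Rightarrow> real" where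
  "T1S_dist x y = Inf {T1H_dist u v | u v. u \<in> x \<and> v \<in> y}"

definition flow :: "real \<Rightarrow> tvec set \<Rightarrow> tvec set" where
  "flow t x = gflow t ` x"

definition leaf :: "tvec set \<Rightarrow> tvec set set" where
  "leaf x = range (\<lambda>t. flow t x)"

definition rev_T1S :: "tvec set \<Rightarrow> tvec set" where
  "rev_T1S x = reverse ` x"


section \<open>Hitchin representations\<close>

definition Hom_space :: "psl2 set \<Rightarrow> (psl2 \<Rightarrow> (real^'n^'n) set) topology" where
  "Hom_space \<Gamma> =
     subtopology (product_topology (\<lambda>_. PSL_top) \<Gamma>) (hom (group_of \<Gamma>) PSL \<inter> extensional \<Gamma>)"

definition conj_orbit :: "psl2 set \<Rightarrow> (psl2 \<Rightarrow> (real^'n^'n) set) \<Rightarrow> (psl2 \<Rightarrow> (real^'n^'n) set) set" where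
  "conj_orbit \<Gamma> \<rho> =
     (\<lambda>g. \<lambda>\<gamma>\<in>\<Gamma>. g \<otimes>\<^bsub>PSL\<^esub> \<rho> \<gamma> \<otimes>\<^bsub>PSL\<^esub> inv\<^bsub>PSL\<^esub> g) ` carrier PSL"

text \<open>In the quotient \<open>Hom(\<Gamma>, PSL\<^sub>n(\<real>)) // PSL\<^sub>n(\<real>)\<close> two homomorphisms are identified iff the
  closures of their conjugacy orbits meet.\<close>

definition character :: "psl2 set \<Rightarrow> (psl2 \<Rightarrow> (real^'n^'n) set) \<Rightarrow> (psl2 \<Rightarrow> (real^'n^'n) set) set" where
  "character \<Gamma> \<rho> = {\<sigma> \<in> topspace (Hom_space \<Gamma>).
     (Hom_space \<Gamma> closure_of conj_orbit \<Gamma> \<rho>) \<inter> (Hom_space \<Gamma> closure_of conj_orbit \<Gamma> \<sigma>) \<noteq> {}}"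

definition character_variety :: "psl2 set \<Rightarrow> (psl2 \<Rightarrow> (real^'n^'n) set) set topology" where
  "character_variety \<Gamma> = quotient_top (Hom_space \<Gamma>) (character \<Gamma>)"

text \<open>Up to conjugation in \<open>GL\<^sub>n(\<real>)\<close> there is exactly one such homomorphism.\<close>

definition irreducible_rep :: "(real^2^2 \<Rightarrow> real^'n^'n) \<Rightarrow> bool" where
  "irreducible_rep \<iota> \<longleftrightarrow>
     \<iota> \<in> hom SL SL \<and> continuous_on (carrier SL) \<iota> \<and>
     (\<forall>W. subspace W \<and> (\<forall>A \<in> carrier SL. (\<lambda>X. \<iota> A *v X) ` W \<subseteq> W) \<longrightarrow> W = {0} \<or> W = UNIV)"

definition fuchsian :: "psl2 set \<Rightarrow> (psl2 \<Rightarrow> (real^'n^'n) set) \<Rightarrow> bool" where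
  "fuchsian \<Gamma> \<sigma> \<longleftrightarrow>
     (\<exists>r \<iota>. r \<in> hom (group_of \<Gamma>) (PSL :: psl2 monoid) \<and> inj_on r \<Gamma> \<and>
        subtopology PSL_top (r ` \<Gamma>) = discrete_topology (r ` \<Gamma>) \<and>
        irreducible_rep \<iota> \<and>
        \<sigma> = (\<lambda>\<gamma>\<in>\<Gamma>. to_PSL (\<iota> (SOME A. A \<in> r \<gamma>))))"

definition hitchin :: "psl2 set \<Rightarrow> (psl2 \<Rightarrow> (real^'n^'n) set) \<Rightarrow> bool" where
  "hitchin \<Gamma> \<rho> \<longleftrightarrow>
     \<rho> \<in> topspace (Hom_space \<Gamma>) \<and>
     (\<exists>\<sigma>. fuchsian \<Gamma> \<sigma> \<and>
        connected_component_of (character_variety \<Gamma>) (character \<Gamma> \<sigma>) (character \<Gamma> \<rho>))"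

definition lifts :: "psl2 set \<Rightarrow> (psl2 \<Rightarrow> (real^'n^'n) set) \<Rightarrow> (psl2 \<Rightarrow> real^'n^'n) \<Rightarrow> bool" where
  "lifts \<Gamma> \<rho> P \<longleftrightarrow> P \<in> hom (group_of \<Gamma>) SL \<and> (\<forall>\<gamma>\<in>\<Gamma>. to_PSL (P \<gamma>) = \<rho> \<gamma>)"

definition spectrum :: "real^'n^'n \<Rightarrow> real set" where
  "spectrum A = {\<mu>. \<exists>X. X \<noteq> 0 \<and> A *v X = \<mu> *\<^sub>R X}"

text \<open>The \<open>i\<close>-th eigenvalue (counting from 1), for matrices whose eigenvalues have distinct
  absolute values.\<close>

definition eigval :: "real^'n^'n \<Rightarrow> nat \<Rightarrow> real" where
  "eigval A i = (THE \<mu>. \<mu> \<in> spectrum A \<and> card {\<nu> \<in> spectrum A. \<bar>\<nu>\<bar> \<ge> \<bar>\<mu>\<bar>} = i)"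


section \<open>Transverse surfaces\<close>

definition transverse_patch :: "complex set \<Rightarrow> (complex \<Rightarrow> tvec) \<Rightarrow> bool" where
  "transverse_patch W s \<longleftrightarrow>
     open W \<and> s ` W \<subseteq> T1H \<and> smooth_on W s \<and>
     (\<forall>w\<in>W. \<forall>a c. frechet_derivative s (at w) a + c *\<^sub>R gfield (s w) = 0 \<longrightarrow> a = 0 \<and> c = 0)"

definition local_param :: "psl2 set \<Rightarrow> tvec set set \<Rightarrow> complex set \<Rightarrow> (complex \<Rightarrow> tvec) \<Rightarrow> bool" where
  "local_param \<Gamma> D W s \<longleftrightarrow>
     transverse_patch W s \<and>
     openin (subtopology (T1S \<Gamma>) D) ((\<lambda>w. orb \<Gamma> (s w)) ` W) \<and>
     homeomorphic_map (top_of_set W) (subtopology (T1S \<Gamma>) ((\<lambda>w. orb \<Gamma> (s w)) ` W))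
       (\<lambda>w. orb \<Gamma> (s w))"

text \<open>Smoothly embedded surfaces without boundary, transverse to the geodesic foliation.\<close>

definition transverse_surface :: "psl2 set \<Rightarrow> tvec set set \<Rightarrow> bool" where
  "transverse_surface \<Gamma> D \<longleftrightarrow>
     D \<subseteq> topspace (T1S \<Gamma>) \<and>
     (\<forall>x\<in>D. \<exists>W s. local_param \<Gamma> D W s \<and> x \<in> (\<lambda>w. orb \<Gamma> (s w)) ` W)"


section \<open>Hoelder geodesic currents\<close>

definition hoelder_fun :: "tvec set set \<Rightarrow> real \<Rightarrow> (tvec set \<Rightarrow> real) \<Rightarrow> bool" where
  "hoelder_fun D \<nu> \<phi> \<longleftrightarrow> (\<exists>C. \<forall>x\<in>D. \<forall>y\<in>D. \<bar>\<phi> x - \<phi> y\<bar> \<le> C * T1S_dist x y powr \<nu>)"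

text \<open>Functions on \<open>D\<close> are extended by zero; thus functions with compact support in a subsurface
  are functions with compact support in \<open>D\<close>.\<close>

definition test_funs_on :: "psl2 set \<Rightarrow> tvec set set \<Rightarrow> tvec set set \<Rightarrow> real \<Rightarrow> (tvec set \<Rightarrow> real) set" where
  "test_funs_on \<Gamma> D K \<nu> = {\<phi>. (\<forall>x. x \<notin> K \<longrightarrow> \<phi> x = 0) \<and> hoelder_fun D \<nu> \<phi>}"

definition test_funs :: "psl2 set \<Rightarrow> tvec set set \<Rightarrow> (tvec set \<Rightarrow> real) set" where
  "test_funs \<Gamma> D =
     {\<phi>. \<exists>K \<nu>. compactin (T1S \<Gamma>) K \<and> K \<subseteq> D \<and> 0 < \<nu> \<and> \<nu> \<le> 1 \<and> \<phi> \<in> test_funs_on \<Gamma> D K \<nu>}"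

definition hoelder_norm :: "tvec set set \<Rightarrow> real \<Rightarrow> (tvec set \<Rightarrow> real) \<Rightarrow> real" where
  "hoelder_norm D \<nu> \<phi> =
     Sup (insert 0 {\<bar>\<phi> x\<bar> | x. x \<in> D}) +
     Sup (insert 0 {\<bar>\<phi> x - \<phi> y\<bar> / T1S_dist x y powr \<nu> | x y. x \<in> D \<and> y \<in> D \<and> x \<noteq> y})"

definition hoelder_distribution :: "psl2 set \<Rightarrow> tvec set set \<Rightarrow> ((tvec set \<Rightarrow> real) \<Rightarrow> real) \<Rightarrow> bool" where
  "hoelder_distribution \<Gamma> D A \<longleftrightarrow>
     (\<forall>\<phi>\<in>test_funs \<Gamma> D. \<forall>\<psi>\<in>test_funs \<Gamma> D. \<forall>a b.
        A (\<lambda>x. a * \<phi> x + b * \<psi> x) = a * A \<phi> + b * A \<psi>) \<and>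
     (\<forall>K \<nu>. compactin (T1S \<Gamma>) K \<and> K \<subseteq> D \<and> 0 < \<nu> \<and> \<nu> \<le> 1 \<longrightarrow>
        (\<exists>C. \<forall>\<phi>\<in>test_funs_on \<Gamma> D K \<nu>. \<bar>A \<phi>\<bar> \<le> C * hoelder_norm D \<nu> \<phi>))"

text \<open>\<open>h\<close> is the end of a Hoelder homotopy that moves every point of \<open>D\<close> inside its leaf,
  and a homeomorphism onto \<open>D'\<close> with Hoelder inverse (so that functions can be transported
  from \<open>D\<close> to \<open>D'\<close>). The Hoelder conditions are imposed on compact subsets of the
  possibly noncompact surfaces.\<close>

definition leaf_homotopy :: "psl2 set \<Rightarrow> tvec set set \<Rightarrow> tvec set set \<Rightarrow> (tvec set \<Rightarrow> tvec set) \<Rightarrow> bool" where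
  "leaf_homotopy \<Gamma> D D' h \<longleftrightarrow>
     (\<exists>H :: tvec set \<Rightarrow> real \<Rightarrow> tvec set.
        (\<forall>x\<in>D. H x 0 = x \<and> H x 1 = h x \<and> (\<forall>s\<in>{0..1}. H x s \<in> leaf x)) \<and>
        (\<forall>K. compactin (T1S \<Gamma>) K \<and> K \<subseteq> D \<longrightarrow>
           (\<exists>C \<nu>. 0 < \<nu> \<and> \<nu> \<le> 1 \<and>
              (\<forall>x\<in>K. \<forall>y\<in>K. \<forall>s\<in>{0..1}. \<forall>t\<in>{0..1}.
                 T1S_dist (H x s) (H y t) \<le> C * (T1S_dist x y + \<bar>s - t\<bar>) powr \<nu>)))) \<and>
     homeomorphic_map (subtopology (T1S \<Gamma>) D) (subtopology (T1S \<Gamma>) D') h \<and>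
     (\<forall>K. compactin (T1S \<Gamma>) K \<and> K \<subseteq> D \<longrightarrow>
        (\<exists>C \<nu>. 0 < \<nu> \<and> \<nu> \<le> 1 \<and>
           (\<forall>x\<in>K. \<forall>y\<in>K. T1S_dist x y \<le> C * T1S_dist (h x) (h y) powr \<nu>)))"

text \<open>A current maps \<open>D\<close> and \<open>\<phi>\<close> to \<open>\<alpha>\<^sub>D(\<phi>)\<close>. The first condition only normalizes the values at
  irrelevant arguments, so that currents with the same distributions are equal.\<close>

type_synonym current = "tvec set set \<Rightarrow> (tvec set \<Rightarrow> real) \<Rightarrow> real"

definition hoelder_currents :: "psl2 set \<Rightarrow> current set" where
  "hoelder_currents \<Gamma> = {\<alpha>.
     (\<forall>D \<phi>. \<not> (transverse_surface \<Gamma> D \<and> \<phi> \<in> test_funs \<Gamma> D) \<longrightarrow> \<alpha> D \<phi> = 0) \<and>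
     (\<forall>D. transverse_surface \<Gamma> D \<longrightarrow> hoelder_distribution \<Gamma> D (\<alpha> D)) \<and>
     (\<forall>D D'. transverse_surface \<Gamma> D \<and> transverse_surface \<Gamma> D' \<and> D' \<subseteq> D \<longrightarrow>
        (\<forall>\<phi>\<in>test_funs \<Gamma> D'. \<alpha> D \<phi> = \<alpha> D' \<phi>)) \<and>
     (\<forall>D D' h. transverse_surface \<Gamma> D \<and> transverse_surface \<Gamma> D' \<and> leaf_homotopy \<Gamma> D D' h \<longrightarrow>
        (\<forall>\<phi>\<in>test_funs \<Gamma> D'. \<alpha> D (\<lambda>x. if x \<in> D then \<phi> (h x) else 0) = \<alpha> D' \<phi>))}"

definition weak_star :: "psl2 set \<Rightarrow> current topology" where
  "weak_star \<Gamma> = topology_generated_by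
     {{\<alpha> \<in> hoelder_currents \<Gamma>. \<alpha> D \<phi> \<in> U} | D \<phi> U.
        transverse_surface \<Gamma> D \<and> \<phi> \<in> test_funs \<Gamma> D \<and> open U}"

text \<open>Every transverse surface is locally compact and second countable, so Borel measures that
  are finite on compact sets are Radon measures.\<close>

definition measure_currents :: "psl2 set \<Rightarrow> current set" where
  "measure_currents \<Gamma> = {\<alpha> \<in> hoelder_currents \<Gamma>. \<forall>D. transverse_surface \<Gamma> D \<longrightarrow>
     (\<exists>M. space M = D \<and> sets M = sigma_sets D {U. openin (subtopology (T1S \<Gamma>) D) U} \<and>
        (\<forall>K. compactin (T1S \<Gamma>) K \<and> K \<subseteq> D \<longrightarrow> emeasure M K < \<infinity>) \<and>
        (\<forall>\<phi>\<in>test_funs \<Gamma> D. integrable M \<phi> \<and> \<alpha> D \<phi> = integral\<^sup>L M \<phi>))}"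


section \<open>Measured laminations\<close>

definition closed_leaf :: "psl2 set \<Rightarrow> psl2 \<Rightarrow> tvec set set" where
  "closed_leaf \<Gamma> \<gamma> = {orb \<Gamma> u | u t. u \<in> T1H \<and> t > 0 \<and> dact \<gamma> u = gflow t u}"

text \<open>The sum is finite, because \<open>\<phi>\<close> has compact support in \<open>D\<close>.\<close>

definition curve_current :: "psl2 set \<Rightarrow> psl2 \<Rightarrow> current" where
  "curve_current \<Gamma> \<gamma> D \<phi> =
     (if transverse_surface \<Gamma> D \<and> \<phi> \<in> test_funs \<Gamma> D
      then \<Sum>x\<in>{x \<in> D \<inter> closed_leaf \<Gamma> \<gamma>. \<phi> x \<noteq> 0}. \<phi> x else 0)"

definition rev_current :: "current \<Rightarrow> current" where
  "rev_current \<alpha> D \<phi> = \<alpha> (rev_T1S ` D) (\<lambda>x. \<phi> (rev_T1S x))"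

definition unoriented_current :: "psl2 set \<Rightarrow> psl2 \<Rightarrow> current" where
  "unoriented_current \<Gamma> \<gamma> D \<phi> =
     1/2 * curve_current \<Gamma> \<gamma> D \<phi> + 1/2 * rev_current (curve_current \<Gamma> \<gamma>) D \<phi>"

text \<open>\<open>\<gamma>\<close> is nontrivial and its free homotopy class contains a simple closed curve: a lift \<open>c\<close>
  of such a curve joins a point to its image under \<open>\<gamma>\<close>. Such a \<open>\<gamma>\<close> is primitive.\<close>

definition simple_class :: "psl2 set \<Rightarrow> psl2 \<Rightarrow> bool" where
  "simple_class \<Gamma> \<gamma> \<longleftrightarrow>
     \<gamma> \<in> \<Gamma> \<and> \<gamma> \<noteq> \<one>\<^bsub>PSL\<^esub> \<and>
     (\<exists>c :: real \<Rightarrow> complex. continuous_on {0..1} c \<and> c ` {0..1} \<subseteq> HP \<and> c 1 = act \<gamma> (c 0) \<and>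
        inj_on (\<lambda>t. (\<lambda>\<delta>. act \<delta> (c t)) ` \<Gamma>) {0..<1})"

definition measured_laminations :: "psl2 set \<Rightarrow> current set" where
  "measured_laminations \<Gamma> = subtopology (weak_star \<Gamma>) (measure_currents \<Gamma>) closure_of
     {\<lambda>D \<phi>. a * unoriented_current \<Gamma> \<gamma> D \<phi> | a \<gamma>. a > 0 \<and> simple_class \<Gamma> \<gamma>}"


section \<open>Length functions\<close>

text \<open>Subbundles, flow and metrics of the flat bundle \<open>(T1H \<times> \<real>\<^sup>n) / \<Gamma>\<close> are written as equivariant
  objects on \<open>T1H\<close>. The lifted flow is \<open>(u, X) \<mapsto> (gflow t u, X)\<close>, so invariance says that
  the line \<open>V i u\<close> is constant along leaves (in particular smooth). If \<open>gflow t u = dact \<gamma> u\<close>, then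
  \<open>(gflow t u, X)\<close> and \<open>(u, P(\<gamma>)\<^sup>-\<^sup>1 X)\<close> are the same point of the bundle. Transverse Hoelder
  continuity means that there are local Hoelder continuous nonzero sections over transverse
  surfaces.\<close>

definition eigenbundles ::
  "psl2 set \<Rightarrow> (psl2 \<Rightarrow> real^'n^'n) \<Rightarrow> (nat \<Rightarrow> tvec \<Rightarrow> (real^'n) set) \<Rightarrow> bool" where
  "eigenbundles \<Gamma> P V \<longleftrightarrow>
     (\<forall>u\<in>T1H. (\<forall>i\<in>{1..CARD('n)}. subspace (V i u) \<and> dim (V i u) = 1) \<and>
        span (\<Union>i\<in>{1..CARD('n)}. V i u) = UNIV) \<and>
     (\<forall>i\<in>{1..CARD('n)}.
        (\<forall>u\<in>T1H. \<forall>\<gamma>\<in>\<Gamma>. V i (dact \<gamma> u) = (\<lambda>X. P \<gamma> *v X) ` V i u) \<and>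
        (\<forall>u\<in>T1H. \<forall>t. V i (gflow t u) = V i u) \<and>
        (\<forall>u\<in>T1H. \<forall>\<gamma>\<in>\<Gamma>. \<forall>t>0. gflow t u = dact \<gamma> u \<longrightarrow>
           (\<forall>X\<in>V i u. matrix_inv (P \<gamma>) *v X = (1 / eigval (P \<gamma>) i) *\<^sub>R X)) \<and>
        (\<forall>W s. transverse_patch W s \<longrightarrow>
           (\<forall>w0\<in>W. \<exists>e>0. \<exists>C \<nu> X. 0 < \<nu> \<and> \<nu> \<le> 1 \<and> ball w0 e \<subseteq> W \<and>
              (\<forall>w\<in>ball w0 e. X w \<in> V i (s w) \<and> X w \<noteq> 0) \<and>
              (\<forall>w\<in>ball w0 e. \<forall>w'\<in>ball w0 e.
                 norm (X w - X w') \<le> C * dist w w' powr \<nu>))))"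

definition bundle_metric ::
  "psl2 set \<Rightarrow> (psl2 \<Rightarrow> real^'n^'n) \<Rightarrow> (tvec \<Rightarrow> real^'n \<Rightarrow> real^'n \<Rightarrow> real) \<Rightarrow> bool" where
  "bundle_metric \<Gamma> P m \<longleftrightarrow>
     (\<forall>u\<in>T1H. bilinear (m u) \<and> (\<forall>X Y. m u X Y = m u Y X) \<and> (\<forall>X. X \<noteq> 0 \<longrightarrow> m u X X > 0)) \<and>
     (\<forall>X Y. smooth_T1H (\<lambda>u. m u X Y)) \<and>
     (\<forall>u\<in>T1H. \<forall>\<gamma>\<in>\<Gamma>. \<forall>X Y. m (dact \<gamma> u) (P \<gamma> *v X) (P \<gamma> *v Y) = m u X Y)"

text \<open>The value of the 1-form \<open>\<omega>\<^sub>i\<close> on the velocity vector of the flow. It depends neither on the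
  lift \<open>u\<close> of \<open>x\<close> nor on the vector \<open>X\<close>.\<close>

definition omega ::
  "(tvec \<Rightarrow> real^'n \<Rightarrow> real^'n \<Rightarrow> real) \<Rightarrow> (tvec \<Rightarrow> (real^'n) set) \<Rightarrow> tvec set \<Rightarrow> real" where
  "omega m V x = (let u = SOME u. u \<in> x; X = SOME X. X \<in> V u \<and> X \<noteq> 0
                  in - deriv (\<lambda>t. ln (sqrt (m (gflow t u) X X))) 0)"

text \<open>The flow box is the image of \<open>D \<times> (0,1)\<close> under \<open>(x, s) \<mapsto> flow (\<tau> x s) x\<close>. The arcs are
  parametrized in the direction of the flow, and each arc passes through its point of \<open>D\<close>.
  Together with transversality of \<open>D\<close>, the condition on \<open>\<tau>\<close> makes the parametrization a
  diffeomorphism.\<close>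

definition box_set :: "tvec set set \<Rightarrow> (tvec set \<Rightarrow> real \<Rightarrow> real) \<Rightarrow> tvec set set" where
  "box_set D \<tau> = (\<lambda>(x, s). flow (\<tau> x s) x) ` (D \<times> {0<..<1})"

definition flow_box :: "psl2 set \<Rightarrow> tvec set set \<Rightarrow> (tvec set \<Rightarrow> real \<Rightarrow> real) \<Rightarrow> bool" where
  "flow_box \<Gamma> D \<tau> \<longleftrightarrow>
     transverse_surface \<Gamma> D \<and>
     (\<forall>W s. local_param \<Gamma> D W s \<longrightarrow>
        smooth_on (W \<times> {0<..<1}) (\<lambda>(w, r). \<tau> (orb \<Gamma> (s w)) r)) \<and>
     (\<forall>x\<in>D. (\<forall>r\<in>{0<..<1}. deriv (\<tau> x) r > 0) \<and> (\<exists>r\<in>{0<..<1}. \<tau> x r = 0)) \<and>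
     openin (T1S \<Gamma>) (box_set D \<tau>) \<and>
     homeomorphic_map (prod_topology (subtopology (T1S \<Gamma>) D) (top_of_set {0<..<1}))
       (subtopology (T1S \<Gamma>) (box_set D \<tau>)) (\<lambda>(x, s). flow (\<tau> x s) x)"

definition flow_box_cover :: "psl2 set \<Rightarrow> nat \<Rightarrow> (nat \<Rightarrow> tvec set set) \<Rightarrow>
    (nat \<Rightarrow> tvec set \<Rightarrow> real \<Rightarrow> real) \<Rightarrow> (nat \<Rightarrow> tvec set \<Rightarrow> real) \<Rightarrow> bool" where
  "flow_box_cover \<Gamma> N D \<tau> \<xi> \<longleftrightarrow>
     (\<forall>j<N. flow_box \<Gamma> (D j) (\<tau> j)) \<and>
     topspace (T1S \<Gamma>) = (\<Union>j<N. box_set (D j) (\<tau> j)) \<and>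
     (\<forall>j<N. smooth_T1H (\<lambda>u. \<xi> j (orb \<Gamma> u)) \<and>
        (\<forall>x\<in>topspace (T1S \<Gamma>). \<xi> j x \<ge> 0) \<and>
        (\<exists>K. compactin (T1S \<Gamma>) K \<and> K \<subseteq> box_set (D j) (\<tau> j) \<and>
           (\<forall>x\<in>topspace (T1S \<Gamma>) - K. \<xi> j x = 0))) \<and>
     (\<forall>x\<in>topspace (T1S \<Gamma>). (\<Sum>j<N. \<xi> j x) = 1)"

text \<open>The integral of \<open>\<xi> \<omega>\<^sub>i\<close> over the arc through \<open>x\<close>, pulled back to the interval.\<close>

definition arc_integral :: "(tvec \<Rightarrow> real^'n \<Rightarrow> real^'n \<Rightarrow> real) \<Rightarrow> (tvec \<Rightarrow> (real^'n) set) \<Rightarrow>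
    tvec set set \<Rightarrow> (tvec set \<Rightarrow> real \<Rightarrow> real) \<Rightarrow> (tvec set \<Rightarrow> real) \<Rightarrow> tvec set \<Rightarrow> real" where
  "arc_integral m V D \<tau> \<xi> x =
     (if x \<in> D
      then integral {0<..<1}
             (\<lambda>s. \<xi> (flow (\<tau> x s) x) * omega m V (flow (\<tau> x s) x) * deriv (\<tau> x) s)
      else 0)"

text \<open>\<open>l\<close> is the \<open>i\<close>-th length function of \<open>\<rho>\<close>, computed with some choice of a lift of \<open>\<rho>\<close>,
  a metric, flow boxes and a partition of unity. The eigenbundles are determined by their
  values on closed orbits, and \<open>l\<close> does not depend on the choices.\<close>

definition length_function ::
  "psl2 set \<Rightarrow> (psl2 \<Rightarrow> (real^'n^'n) set) \<Rightarrow> nat \<Rightarrow> (current \<Rightarrow> real) \<Rightarrow> bool" where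
  "length_function \<Gamma> \<rho> i l \<longleftrightarrow>
     (\<exists>P V m N D \<tau> \<xi>. lifts \<Gamma> \<rho> P \<and> eigenbundles \<Gamma> P V \<and> bundle_metric \<Gamma> P m \<and>
        flow_box_cover \<Gamma> N D \<tau> \<xi> \<and>
        (\<forall>\<alpha>\<in>hoelder_currents \<Gamma>.
           l \<alpha> = (\<Sum>j<N. \<alpha> (D j) (arc_integral m (V i) (D j) (\<tau> j) (\<xi> j)))))"

end

theory Submission
  imports Defs
begin

text \<open>By definition of the weak-* topology, every evaluation \<open>\<alpha> \<mapsto> \<alpha>\<^sub>D(\<phi>)\<close> is continuous, and the
  length function is a finite sum of such evaluations. Hence the difference quotients of
  \<open>t \<mapsto> l (\<alpha> t)\<close> are the values of that sum on the difference quotients of \<open>\<alpha>\<close>.\<close>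

text \<open>Each generating set of the topology consists of currents. Since \<open>limitin\<close>
  puts the limit in the space, this makes weak-* limits currents.\<close>

lemma topspace_weak_star_subset: "topspace (weak_star \<Gamma>) \<subseteq> hoelder_currents \<Gamma>"
  unfolding weak_star_def by auto

lemma measured_laminations_subset_hoelder_currents:
  "measured_laminations \<Gamma> \<subseteq> hoelder_currents \<Gamma>"
proof -
  have "measured_laminations \<Gamma> \<subseteq> topspace (subtopology (weak_star \<Gamma>) (measure_currents \<Gamma>))"
    unfolding measured_laminations_def by (rule closure_of_subset_topspace)
  then show ?thesis using topspace_weak_star_subset by auto
qed

lemma hoelder_currents_irrelevant:
  assumes "\<alpha> \<in> hoelder_currents \<Gamma>" and "\<not> (transverse_surface \<Gamma> D \<and> \<phi> \<in> test_funs \<Gamma> D)"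
  shows "\<alpha> D \<phi> = 0"
  using conjunct1[OF assms(1)[unfolded hoelder_currents_def mem_Collect_eq]] assms(2) by blast

text \<open>Evaluations at irrelevant arguments vanish on all currents, so \<open>\<phi>\<close> can be arbitrary.\<close>

lemma limitin_weak_star_imp_tendsto:
  assumes lim: "limitin (weak_star \<Gamma>) \<beta> \<beta>' F"
  shows "tendsto (\<lambda>t. \<beta> t D \<phi>) (\<beta>' D \<phi>) F"
proof (cases "transverse_surface \<Gamma> D \<and> \<phi> \<in> test_funs \<Gamma> D")
  case True
  have \<beta>': "\<beta>' \<in> hoelder_currents \<Gamma>"
    by (rule subsetD[OF topspace_weak_star_subset limitin_topspace[OF lim]])
  show ?thesis
  proof (rule topological_tendstoI)
    fix U :: "real set"
    assume U: "open U" "\<beta>' D \<phi> \<in> U"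
    let ?B = "{\<alpha> \<in> hoelder_currents \<Gamma>. \<alpha> D \<phi> \<in> U}"
    have "openin (weak_star \<Gamma>) ?B"
      unfolding weak_star_def by (rule topology_generated_by_Basis) (use True U(1) in blast)
    moreover have "\<beta>' \<in> ?B"
      using \<beta>' U(2) by simp
    ultimately have "\<forall>\<^sub>F t in F. \<beta> t \<in> ?B"
      by (intro conjunct2[OF lim[unfolded limitin_def], rule_format] conjI)
    then show "\<forall>\<^sub>F t in F. \<beta> t D \<phi> \<in> U"
      by (rule eventually_mono) simp
  qed
next
  case False
  have zero: "\<alpha> D \<phi> = 0" if "\<alpha> \<in> topspace (weak_star \<Gamma>)" for \<alpha>
    using subsetD[OF topspace_weak_star_subset that] False by (rule hoelder_currents_irrelevant)
  \<comment> \<open>The whole space is an open neighbourhood of the limit, so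
    \<open>\<beta> t\<close> is a current eventually.\<close>
  have "\<forall>\<^sub>F t in F. \<beta> t \<in> topspace (weak_star \<Gamma>)"
    using lim by (simp add: limitin_def)
  then have "\<forall>\<^sub>F t in F. \<beta> t D \<phi> = \<beta>' D \<phi>"
    by (rule eventually_mono) (simp add: zero limitin_topspace[OF lim])
  then show ?thesis
    by (rule tendsto_eventually)
qed

theorem theorem4:
  fixes \<Gamma> :: "psl2 set"
    and genus :: nat
    and \<rho> :: "psl2 \<Rightarrow> (real^'n^'n) set"
    and i :: nat
    and l :: "current \<Rightarrow> real"
    and \<alpha> :: "real \<Rightarrow> current"
    and \<alpha>' :: current
  assumes "CARD('n) \<ge> 2"
    and "genus \<ge> 2"
    and "closed_hyperbolic_surface \<Gamma> genus"
    and "hitchin \<Gamma> \<rho>"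
    and "i \<in> {1..CARD('n)}"
    and "length_function \<Gamma> \<rho> i l"
    and "\<And>t. t \<ge> 0 \<Longrightarrow> \<alpha> t \<in> measured_laminations \<Gamma>"
    and "limitin (weak_star \<Gamma>) (\<lambda>t D \<phi>. (\<alpha> t D \<phi> - \<alpha> 0 D \<phi>) / t) \<alpha>' (at_right 0)"
  shows "((\<lambda>t. l (\<alpha> t)) has_real_derivative l \<alpha>') (at_right 0)"
proof -
  \<comment> \<open>Fixes one choice of lift, eigenbundles, metric, flow boxes and partition of
    unity; \<open>\<phi> j\<close> is the resulting arc integral on \<open>D j\<close>.\<close>
  obtain N :: nat and D \<phi>
    where l: "\<And>\<beta>. \<beta> \<in> hoelder_currents \<Gamma> \<Longrightarrow> l \<beta> = (\<Sum>j<N. \<beta> (D j) (\<phi> j))"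
    using assms(6) unfolding length_function_def
    by (elim exE conjE) (rule that, erule (1) bspec)
  have \<alpha>: "\<alpha> t \<in> hoelder_currents \<Gamma>" if "t \<ge> 0" for t
    by (rule subsetD[OF measured_laminations_subset_hoelder_currents assms(7)[OF that]])
  have \<alpha>': "\<alpha>' \<in> hoelder_currents \<Gamma>"
    by (rule subsetD[OF topspace_weak_star_subset limitin_topspace[OF assms(8)]])
  have "tendsto (\<lambda>t. \<Sum>j<N. (\<alpha> t (D j) (\<phi> j) - \<alpha> 0 (D j) (\<phi> j)) / t) (l \<alpha>') (at_right 0)"
    unfolding l[OF \<alpha>'] by (intro tendsto_sum limitin_weak_star_imp_tendsto[OF assms(8)])
  \<comment> \<open>The sum formula for \<open>l\<close> holds on currents, so it is applied to
    \<open>\<alpha> t\<close> and \<open>\<alpha> 0\<close> separately, not to their difference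
    quotient. The form \<open>t - 0\<close> matches the definition of the derivative at 0.\<close>
  moreover have "\<forall>\<^sub>F t in at_right 0.
      (\<Sum>j<N. (\<alpha> t (D j) (\<phi> j) - \<alpha> 0 (D j) (\<phi> j)) / t) = (l (\<alpha> t) - l (\<alpha> 0)) / (t - 0)"
    using eventually_at_right_less[of 0]
    by (rule eventually_mono) (simp add: l \<alpha> sum_subtractf flip: sum_divide_distrib)
  ultimately show ?thesis
    unfolding has_field_derivative_iff by (rule Lim_transform_eventually)
qed

end
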